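(* Let $(X,\mathcal{B},\mathbf{b})$ be a coarse proximity space, and for $A,B\subseteq X$ write $A\ll B$ if $A\bar{\mathbf{b}}(X\setminus B)$. Then the relation $\ll$ satisfies the following properties for all subsets $A,B,B_1,B_2,C,D$ of $X$: (1) $X\ll (X\setminus D)$ for all $D\in\mathcal{B}$; (2) $A\ll B$ implies that there exists $D\in\mathcal{B}$ such that $A\setminus D\subseteq B$; (3) $A\subseteq B\ll C\subseteq D$ implies $A\ll D$; (4) $A\ll B_1$ and $A\ll B_2$ if and only if $A\ll (B_1\cap B_2)$; (5) $A\ll B$ if and only if $(X\setminus B)\ll (X\setminus A)$; (6) $A\ll B$ implies that there exists $C\subseteq X$ such that $A\ll C\ll B$.
   Context: A bornology on a set $X$ is a family $\mathcal{B}$ of subsets of $X$ such that: $\{x\}\in\mathcal{B}$ for all $x\in X$; $A\in\mathcal{B}$ and $B\subseteq A$ imply $B\in\mathcal{B}$; $A,B\in\mathcal{B}$ implies $A\cup B\in\mathcal{B}$. A coarse proximity space is a triple $(X,\mathcal{B},\mathbf{b})$ where $X$ is a set, $\mathcal{B}$ is a bornology on $X$, and $\mathbf{b}$ is a coarse proximity, i.e. a relation on the power set of $X$ such that for all $A,B,C\subseteq X$ (writing $\bar{\mathbf{b}}$ for the negation of $\mathbf{b}$): (i) $A\mathbf{b}B$ implies $B\mathbf{b}A$; (ii) $A\mathbf{b}B$ implies $A\notin\mathcal{B}$ and $B\notin\mathcal{B}$; (iii) $A\cap B\notin\mathcal{B}$ implies $A\mathbf{b}B$; (iv) $(A\cup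 B)\mathbf{b}C$ if and only if $A\mathbf{b}C$ or $B\mathbf{b}C$; (v) $A\bar{\mathbf{b}}B$ implies that there exists $E\subseteq X$ with $A\bar{\mathbf{b}}E$ and $(X\setminus E)\bar{\mathbf{b}}B$. *)

theory Defs
  imports Main
begin

definition bornology_on :: "'a set \<Rightarrow> 'a set set \<Rightarrow> bool" where
  "bornology_on X \<B> \<longleftrightarrow>
     \<B> \<subseteq> Pow X \<and>
     (\<forall>x\<in>X. {x} \<in> \<B>) \<and>
     (\<forall>A B. A \<in> \<B> \<longrightarrow> B \<subseteq> A \<longrightarrow> B \<in> \<B>) \<and>
     (\<forall>A B. A \<in> \<B> \<longrightarrow> B \<in> \<B> \<longrightarrow> A \<union> B \<in> \<B>)"

(* The relation b on the power set of X is a binary predicate on all sets of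
   the ambient type; only its values on subsets of X are constrained or used. *)
locale coarse_proximity_space =
  fixes X :: "'a set"
    and \<B> :: "'a set set"
    and b :: "'a set \<Rightarrow> 'a set \<Rightarrow> bool"
  assumes bornology: "bornology_on X \<B>"
    and sym: "\<lbrakk>A \<subseteq> X; B \<subseteq> X; b A B\<rbrakk> \<Longrightarrow> b B A"
    and unbounded: "\<lbrakk>A \<subseteq> X; B \<subseteq> X; b A B\<rbrakk> \<Longrightarrow> A \<notin> \<B> \<and> B \<notin> \<B>"
    and inter: "\<lbrakk>A \<subseteq> X; B \<subseteq> X; A \<inter> B \<notin> \<B>\<rbrakk> \<Longrightarrow> b A B"
    and union: "\<lbrakk>A \<subseteq> X; B \<subseteq> X; C \<subseteq> X\<rbrakk> \<Longrightarrow> b (A \<union> B) C \<longleftrightarrow> b A C \<or> b B C"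
    and strong: "\<lbrakk>A \<subseteq> X; B \<subseteq> X; \<not> b A B\<rbrakk> \<Longrightarrow>
      \<exists>E. E \<subseteq> X \<and> \<not> b A E \<and> \<not> b (X - E) B"

definition coarse_nbhd ::
    "'a set \<Rightarrow> ('a set \<Rightarrow> 'a set \<Rightarrow> bool) \<Rightarrow> 'a set \<Rightarrow> 'a set \<Rightarrow> bool"
    where
  "coarse_nbhd X b A B \<longleftrightarrow> \<not> b A (X - B)"

abbreviation coarse_nbhd_infix ("(_ \<ll>[_,_] _)" [51, 0, 0, 51] 50) where
  "A \<ll>[X,b] B \<equiv> coarse_nbhd X b A B"

end

theory Submission
  imports Defs
begin

text \<open>
  Every property of \<open>\<ll>\<close> is an axiom of the coarse proximity read through complements in \<open>X\<close>.
  The first two express that bounded sets are close to nothing and that sets which are not close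
  meet in a bounded set, which serves as the exceptional set \<open>D\<close> in the second.
  The union axiom makes closeness monotone in both arguments, which yields the third property,
  and, as \<open>X - (B\<^sub>1 \<inter> B\<^sub>2) = (X - B\<^sub>1) \<union> (X - B\<^sub>2)\<close>, it also yields the fourth.
  The fifth is the symmetry of \<open>b\<close>. For the last, if \<open>E\<close> is the set that the strong axiom provides
  for \<open>A\<close> and \<open>X - B\<close>, then \<open>X - E\<close> interpolates between \<open>A\<close> and \<open>B\<close>.
\<close>

context coarse_proximity_space
begin

lemma bounded_subset: "D \<in> \<B> \<Longrightarrow> D \<subseteq> X"
  using bornology by (auto simp: bornology_on_def)

lemma sym_iff: "\<lbrakk>A \<subseteq> X; B \<subseteq> X\<rbrakk> \<Longrightarrow> b A B \<longleftrightarrow> b B A"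
  using sym by blast

lemma union_right:
  assumes "A \<subseteq> X" "B \<subseteq> X" "C \<subseteq> X"
  shows "b C (A \<union> B) \<longleftrightarrow> b C A \<or> b C B"
  using union[OF assms] sym_iff[of C "A \<union> B"] sym_iff[of C A] sym_iff[of C B] assms by simp

lemma mono:
  assumes "b A B" "A \<subseteq> A'" "B \<subseteq> B'" "A' \<subseteq> X" "B' \<subseteq> X"
  shows "b A' B'"
proof -
  have sub: "A \<subseteq> X" "B \<subseteq> X" using assms by auto
  have "b (A \<union> A') B" using union[of A A' B] assms sub by simp
  hence "b A' B" using assms(2) by (simp add: Un_absorb1)
  hence "b A' (B \<union> B')" using union_right[of B B' A'] assms sub by simp
  thus ?thesis using assms(3) by (simp add: Un_absorb1)
qed

lemma nbhd_complement_bounded: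
  assumes "D \<in> \<B>"
  shows "X \<ll>[X,b] (X - D)"
  using unbounded[of X D] bounded_subset[OF assms] assms
  by (auto simp: coarse_nbhd_def double_diff)

lemma nbhd_imp_almost_subset:
  assumes "A \<subseteq> X" "A \<ll>[X,b] B"
  shows "\<exists>D\<in>\<B>. A - D \<subseteq> B"
proof
  show "A \<inter> (X - B) \<in> \<B>" using inter[of A "X - B"] assms by (auto simp: coarse_nbhd_def)
  show "A - A \<inter> (X - B) \<subseteq> B" using assms(1) by blast
qed

lemma nbhd_mono:
  assumes "A \<subseteq> B" "B \<subseteq> X" "B \<ll>[X,b] C" "C \<subseteq> D"
  shows "A \<ll>[X,b] D"
  using mono[of A "X - D" B "X - C"] assms by (auto simp: coarse_nbhd_def)

lemma nbhd_Int_iff: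
  assumes "A \<subseteq> X"
  shows "A \<ll>[X,b] (B \<inter> C) \<longleftrightarrow> A \<ll>[X,b] B \<and> A \<ll>[X,b] C"
  using union_right[of "X - B" "X - C" A] assms by (simp add: coarse_nbhd_def Diff_Int)

lemma nbhd_complement_iff:
  assumes "A \<subseteq> X"
  shows "A \<ll>[X,b] B \<longleftrightarrow> (X - B) \<ll>[X,b] (X - A)"
  using sym_iff[of A "X - B"] assms by (auto simp: coarse_nbhd_def double_diff)

lemma nbhd_interpolate:
  assumes "A \<subseteq> X" "A \<ll>[X,b] B"
  shows "\<exists>C\<subseteq>X. A \<ll>[X,b] C \<and> C \<ll>[X,b] B"
proof -
  obtain E where "E \<subseteq> X" "\<not> b A E" "\<not> b (X - E) (X - B)"
    using strong[of A "X - B"] assms by (auto simp: coarse_nbhd_def)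
  thus ?thesis
    by (intro exI[of _ "X - E"]) (auto simp: coarse_nbhd_def double_diff)
qed

end

theorem theorem2p4:
  fixes X :: "'a set" and \<B> :: "'a set set" and b :: "'a set \<Rightarrow> 'a set \<Rightarrow> bool"
  assumes "coarse_proximity_space X \<B> b"
  shows "(\<forall>D\<in>\<B>. X \<ll>[X,b] (X - D)) \<and>
    (\<forall>A\<subseteq>X. \<forall>B\<subseteq>X. A \<ll>[X,b] B \<longrightarrow> (\<exists>D\<in>\<B>. A - D \<subseteq> B)) \<and>
    (\<forall>A\<subseteq>X. \<forall>B\<subseteq>X. \<forall>C\<subseteq>X. \<forall>D\<subseteq>X.
       A \<subseteq> B \<and> B \<ll>[X,b] C \<and> C \<subseteq> D \<longrightarrow> A \<ll>[X,b] D) \<and>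
    (\<forall>A\<subseteq>X. \<forall>B\<^sub>1\<subseteq>X. \<forall>B\<^sub>2\<subseteq>X.
       (A \<ll>[X,b] B\<^sub>1 \<and> A \<ll>[X,b] B\<^sub>2) \<longleftrightarrow> A \<ll>[X,b] (B\<^sub>1 \<inter> B\<^sub>2)) \<and>
    (\<forall>A\<subseteq>X. \<forall>B\<subseteq>X. A \<ll>[X,b] B \<longleftrightarrow> (X - B) \<ll>[X,b] (X - A)) \<and>
    (\<forall>A\<subseteq>X. \<forall>B\<subseteq>X. A \<ll>[X,b] B \<longrightarrow> (\<exists>C\<subseteq>X. A \<ll>[X,b] C \<and> C \<ll>[X,b] B))"
proof -
  interpret coarse_proximity_space X \<B> b by (fact assms)
  show ?thesis
    apply (intro conjI allI impI ballI)
          apply (erule nbhd_complement_bounded)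
         apply (erule (1) nbhd_imp_almost_subset)
        apply (blast intro: nbhd_mono)
       apply (simp only: nbhd_Int_iff)
      apply (erule nbhd_complement_iff)
     apply (erule (1) nbhd_interpolate)
    done
qed

end
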